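(* Let $d_1,d_2,d_3>0$, and consider the pair of tetrahedra $P_1P_2P_3P_4$ (fixed) and $Q_1Q_2Q_3Q_4$ (moving) derived from the rectangular parallelepiped with vertices $(\pm d_1,\pm d_2,\pm d_3)$, where $P_1=(d_1,-d_2,-d_3)$, $P_2=(-d_1,d_2,-d_3)$, $P_3=(-d_1,-d_2,d_3)$, $P_4=(d_1,d_2,d_3)$, and in the basic position $Q_i$ is $-P_i$. For them the generalized admitted finite motions are identical with the admitted finite motions; that is, an isometry $\Phi(x)=Ax+b$ of $\mathbb{R}^3$ with $A\in SO(3)$, $b\in\mathbb{R}^3$, is a generalized admitted motion if and only if it is an admitted motion.
   Context: A motion is an isometry $\Phi(x)=Ax+b$ of $\mathbb{R}^3$ of determinant $+1$; it is applied to the basic position of the moving tetrahedron, so its vertices become $Q_i=\Phi(-P_i)$, $i=1,\dots,4$, while $P_1P_2P_3P_4$ stays fixed. Admitted motion: for every permutation $(ijkl)$ of $\{1,2,3,4\}$, the points $P_i,P_j,Q_k,Q_l$ are coplanar (i.e. each pair of edges of the two tetrahedra which were originally the diagonals of a face of the parallelepiped remains coplanar). Generalized admitted motion: for every permutation $(ijkl)$ of $\{1,2,3,4\}$, the signed volume of the tetrahedron $P_iP_jQ_kQ_l$ is either $0$ or has the opposite sign to that of the tetrahedron $P_iP_jR_kR_l$, where the segment $R_kR_l$ is the translate of the basic position $(-P_k)(-P_l)$ of the segment $Q_kQ_l$ whose midpoint is the centre (the origin) of the parallelepiped; i.e. $R_k=(P_l-P_k)/2$, $R_l=(P_k-P_l)/2$.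 The signed volume of a tetrahedron $XYZW$ is $\frac16\det(Y-X,\,Z-X,\,W-X)$. *)

theory Defs
  imports "HOL-Analysis.Analysis"
begin

text \<open>Indices run over \<open>{1, 2, 3, 4}\<close>; the value \<open>0\<close> for other indices is junk
  and never used.\<close>

definition P_vertex :: "real \<Rightarrow> real \<Rightarrow> real \<Rightarrow> nat \<Rightarrow> real^3" where
  "P_vertex d1 d2 d3 i =
    (if i = 1 then vector [d1, - d2, - d3]
     else if i = 2 then vector [- d1, d2, - d3]
     else if i = 3 then vector [- d1, - d2, d3]
     else if i = 4 then vector [d1, d2, d3]
     else 0)"

definition is_motion :: "(real^3 \<Rightarrow> real^3) \<Rightarrow> bool" where
  "is_motion \<Phi> \<longleftrightarrow> (\<exists>A b. rotation_matrix A \<and> \<Phi> = (\<lambda>x. A *v x + b))"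

text \<open>The basic position of the moving tetrahedron is \<open>- P\<^sub>1, \<dots>, - P\<^sub>4\<close>.\<close>

definition Q_vertex ::
    "real \<Rightarrow> real \<Rightarrow> real \<Rightarrow> (real^3 \<Rightarrow> real^3) \<Rightarrow> nat \<Rightarrow> real^3" where
  "Q_vertex d1 d2 d3 \<Phi> i = \<Phi> (- P_vertex d1 d2 d3 i)"

text \<open>\<open>R_vertex d1 d2 d3 k l\<close> is the endpoint \<open>R\<^sub>k\<close> of the segment \<open>R\<^sub>k R\<^sub>l\<close>, the translate of
  the segment from \<open>- P\<^sub>k\<close> to \<open>- P\<^sub>l\<close> whose midpoint is the origin; the other endpoint \<open>R\<^sub>l\<close> is
  \<open>R_vertex d1 d2 d3 l k\<close>.\<close>

definition R_vertex :: "real \<Rightarrow> real \<Rightarrow> real \<Rightarrow> nat \<Rightarrow> nat \<Rightarrow> real^3" where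
  "R_vertex d1 d2 d3 k l = (1/2) *\<^sub>R (P_vertex d1 d2 d3 l - P_vertex d1 d2 d3 k)"

lemma R_vertex_eq_translate:
  "R_vertex d1 d2 d3 k l =
    - P_vertex d1 d2 d3 k - midpoint (- P_vertex d1 d2 d3 k) (- P_vertex d1 d2 d3 l)"
  by (simp add: R_vertex_def midpoint_def vec_eq_iff field_simps)

definition signed_volume :: "real^3 \<Rightarrow> real^3 \<Rightarrow> real^3 \<Rightarrow> real^3 \<Rightarrow> real" where
  "signed_volume X Y Z W = (1/6) * det (vector [Y - X, Z - X, W - X] :: real^3^3)"

definition admitted_motion ::
    "real \<Rightarrow> real \<Rightarrow> real \<Rightarrow> (real^3 \<Rightarrow> real^3) \<Rightarrow> bool" where
  "admitted_motion d1 d2 d3 \<Phi> \<longleftrightarrow>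
    is_motion \<Phi> \<and>
    (\<forall>\<sigma>. \<sigma> permutes {1, 2, 3, 4} \<longrightarrow>
      coplanar {P_vertex d1 d2 d3 (\<sigma> 1), P_vertex d1 d2 d3 (\<sigma> 2),
                Q_vertex d1 d2 d3 \<Phi> (\<sigma> 3), Q_vertex d1 d2 d3 \<Phi> (\<sigma> 4)})"

definition generalized_admitted_motion ::
    "real \<Rightarrow> real \<Rightarrow> real \<Rightarrow> (real^3 \<Rightarrow> real^3) \<Rightarrow> bool" where
  "generalized_admitted_motion d1 d2 d3 \<Phi> \<longleftrightarrow>
    is_motion \<Phi> \<and>
    (\<forall>\<sigma>. \<sigma> permutes {1, 2, 3, 4} \<longrightarrow>
      (let V = signed_volume (P_vertex d1 d2 d3 (\<sigma> 1)) (P_vertex d1 d2 d3 (\<sigma> 2))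
                 (Q_vertex d1 d2 d3 \<Phi> (\<sigma> 3)) (Q_vertex d1 d2 d3 \<Phi> (\<sigma> 4));
           V0 = signed_volume (P_vertex d1 d2 d3 (\<sigma> 1)) (P_vertex d1 d2 d3 (\<sigma> 2))
                 (R_vertex d1 d2 d3 (\<sigma> 3) (\<sigma> 4)) (R_vertex d1 d2 d3 (\<sigma> 4) (\<sigma> 3))
       in V = 0 \<or> sgn V = - sgn V0))"

end

theory Submission
  imports Defs
begin

text \<open>Choose one ordering of the vertices for each of the six pairs of edges so that all volumes in
  the basic position equal \<open>-4/3 d1 d2 d3\<close>. For these orderings a generalized admitted motion makes
  all six volumes nonnegative. However, for every motion their sum vanishes: the contributions of the
  translation telescope, and the rest is a multiple of the trace of the cofactor matrix of \<open>A\<close> minus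
  the trace of \<open>A\<close>, which is \<open>0\<close> because a rotation is its own cofactor matrix. Hence all six volumes
  are \<open>0\<close>.\<close>

lemma affine_dependence_imp_coplanar:
  fixes X Y Z W :: "'a::euclidean_space"
  assumes eq: "a *\<^sub>R (Y - X) + b *\<^sub>R (Z - X) + c *\<^sub>R (W - X) = 0" and "c \<noteq> 0"
  shows "coplanar {X, Y, Z, W}"
proof -
  have "c *\<^sub>R W = (a + b + c) *\<^sub>R X + (- a) *\<^sub>R Y + (- b) *\<^sub>R Z"
    using eq by (simp add: algebra_simps eq_neg_iff_add_eq_0)
  then have "W = inverse c *\<^sub>R ((a + b + c) *\<^sub>R X + (- a) *\<^sub>R Y + (- b) *\<^sub>R Z)"
    using \<open>c \<noteq> 0\<close> by (metis scaleR_scaleR left_inverse scaleR_one)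
  then have "W = ((a + b + c) / c) *\<^sub>R X + (- a / c) *\<^sub>R Y + (- b / c) *\<^sub>R Z"
    by (simp add: scaleR_add_right scaleR_diff_right divide_inverse mult.commute)
  moreover have "(a + b + c) / c + (- a / c) + (- b / c) = 1"
    using \<open>c \<noteq> 0\<close> by (simp add: field_simps)
  ultimately have "W \<in> affine hull {X, Y, Z}"
    unfolding affine_hull_3 by blast
  then have "{X, Y, Z, W} \<subseteq> affine hull {X, Y, Z}"
    by (simp add: hull_inc)
  then show ?thesis
    unfolding coplanar_def by blast
qed

lemma coplanar_iff_signed_volume_eq_0:
  "coplanar {X, Y, Z, W} \<longleftrightarrow> signed_volume X Y Z W = 0"
proof
  assume "coplanar {X, Y, Z, W}"
  then obtain u v w where hull: "{X, Y, Z, W} \<subseteq> affine hull {u, v, w}"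
    unfolding coplanar_def by blast
  have rep: "\<exists>s t. T = u + s *\<^sub>R (v - u) + t *\<^sub>R (w - u)" if T: "T \<in> {X, Y, Z, W}" for T
  proof -
    have "T \<in> affine hull {u, v, w}"
      using hull T by (rule subsetD)
    then obtain r s t where "T = r *\<^sub>R u + s *\<^sub>R v + t *\<^sub>R w" "r + s + t = 1"
      by (auto simp: affine_hull_3)
    moreover from \<open>r + s + t = 1\<close> have "r = 1 - s - t" by simp
    ultimately have "T = u + s *\<^sub>R (v - u) + t *\<^sub>R (w - u)"
      by (simp add: algebra_simps)
    then show ?thesis by blast
  qed
  have diff: "\<exists>s t. T - X = s *\<^sub>R (v - u) + t *\<^sub>R (w - u)" if T: "T \<in> {X, Y, Z, W}" for T
  proof -
    obtain s t s' t' where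
      "T = u + s *\<^sub>R (v - u) + t *\<^sub>R (w - u)" "X = u + s' *\<^sub>R (v - u) + t' *\<^sub>R (w - u)"
      using rep[OF T] rep[of X] by blast
    then have "T - X = (s - s') *\<^sub>R (v - u) + (t - t') *\<^sub>R (w - u)"
      by (simp add: scaleR_left_diff_distrib)
    then show ?thesis by blast
  qed
  obtain ys yt zs zt ws wt where
    "Y - X = ys *\<^sub>R (v - u) + yt *\<^sub>R (w - u)" "Z - X = zs *\<^sub>R (v - u) + zt *\<^sub>R (w - u)"
    "W - X = ws *\<^sub>R (v - u) + wt *\<^sub>R (w - u)"
    using diff[of Y] diff[of Z] diff[of W] by blast
  \<comment> \<open>Three rows in the span of the two vectors \<open>p\<close> and \<open>q\<close>
    are linearly dependent.\<close>
  moreover have "det (vector [ys *\<^sub>R p + yt *\<^sub>R q, zs *\<^sub>R p + zt *\<^sub>R q,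
      ws *\<^sub>R p + wt *\<^sub>R q] :: real^3^3) = 0"
    for p q :: "real^3"
    by (simp add: det_3 algebra_simps)
  ultimately show "signed_volume X Y Z W = 0"
    by (simp add: signed_volume_def)
next
  let ?M = "vector [Y - X, Z - X, W - X] :: real^3^3"
  assume "signed_volume X Y Z W = 0"
  \<comment> \<open>The edge vectors are the rows of \<open>?M\<close>, so a nonzero kernel vector
    of the transpose lists the coefficients of a nontrivial relation between them.\<close>
  then have "det (transpose ?M) = 0"
    by (simp add: signed_volume_def det_transpose)
  then obtain c where c: "transpose ?M *v c = 0" "c \<noteq> 0"
    using invertible_det_nz invertible_left_inverse matrix_left_invertible_ker by metis
  have eq: "c$1 *\<^sub>R (Y - X) + c$2 *\<^sub>R (Z - X) + c$3 *\<^sub>R (W - X) = 0"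
    using c(1) by (simp add: vec_eq_iff matrix_vector_mult_def transpose_def sum_3 mult.commute)
  \<comment> \<open>The relation can be solved for any point with nonzero coefficient; in each case
    that point is moved to the last place.\<close>
  consider "c$1 \<noteq> 0" | "c$2 \<noteq> 0" | "c$3 \<noteq> 0"
    using c(2) by (auto simp: vec_eq_iff forall_3)
  then show "coplanar {X, Y, Z, W}"
  proof cases
    case 1
    have "coplanar {X, Z, W, Y}"
      using eq 1 by (intro affine_dependence_imp_coplanar[of "c$2" Z X "c$3" W "c$1" Y])
        (simp_all add: ac_simps)
    then show ?thesis by (simp add: insert_commute)
  next
    case 2
    have "coplanar {X, Y, W, Z}"
      using eq 2 by (intro affine_dependence_imp_coplanar[of "c$1" Y X "c$3" W "c$2" Z])
        (simp_all add: ac_simps)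
    then show ?thesis by (simp add: insert_commute)
  next
    case 3
    with eq show ?thesis by (rule affine_dependence_imp_coplanar)
  qed
qed

lemma signed_volume_swap:
  "signed_volume Y X Z W = - signed_volume X Y Z W"
  "signed_volume X Y W Z = - signed_volume X Y Z W"
  by (simp_all add: signed_volume_def det_3 field_simps)

text \<open>A rotation commutes with the cross product, so each column is the cross product of the
  other two in cyclic order. Only the diagonal entries are recorded, since the volume sum involves
  just the traces.\<close>

lemma rotation_matrix_eq_cofactor:
  fixes A :: "real^3^3"
  assumes "rotation_matrix A"
  shows "A$1$1 = A$2$2 * A$3$3 - A$2$3 * A$3$2"
    and "A$2$2 = A$1$1 * A$3$3 - A$1$3 * A$3$1"
    and "A$3$3 = A$1$1 * A$2$2 - A$1$2 * A$2$1"
proof -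
  note cross = cross_rotation_matrix[OF assms]
  show "A$1$1 = A$2$2 * A$3$3 - A$2$3 * A$3$2"
    using cross[of "axis 2 1" "axis 3 1"]
    by (simp add: cross_basis matrix_vector_mul_component vec_eq_iff forall_3 cross_components
        inner_axis algebra_simps)
  show "A$2$2 = A$1$1 * A$3$3 - A$1$3 * A$3$1"
    using cross[of "axis 3 1" "axis 1 1"]
    by (simp add: cross_basis matrix_vector_mul_component vec_eq_iff forall_3 cross_components
        inner_axis algebra_simps)
  show "A$3$3 = A$1$1 * A$2$2 - A$1$2 * A$2$1"
    using cross[of "axis 1 1" "axis 2 1"]
    by (simp add: cross_basis matrix_vector_mul_component vec_eq_iff forall_3 cross_components
        inner_axis algebra_simps)
qed

lemma permutes_4_iff:
  "(\<forall>\<sigma>. \<sigma> permutes {1, 2, 3, 4::nat} \<longrightarrow> R (\<sigma> 1) (\<sigma> 2) (\<sigma> 3) (\<sigma> 4)) \<longleftrightarrow>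
   (\<forall>i j k l. {i, j, k, l} = {1, 2, 3, 4} \<longrightarrow> R i j k l)"
proof (intro iffI allI impI)
  fix i j k l :: nat
  assume R: "\<forall>\<sigma>. \<sigma> permutes {1, 2, 3, 4::nat} \<longrightarrow> R (\<sigma> 1) (\<sigma> 2) (\<sigma> 3) (\<sigma> 4)"
    and eq: "{i, j, k, l} = {1, 2, 3, 4}"
  define \<sigma> where "\<sigma> = id(1 := i, 2 := j, 3 := k, 4 := l)"
  have "\<sigma> ` {1, 2, 3, 4} = {1, 2, 3, 4}"
    using eq by (simp add: \<sigma>_def)
  \<comment> \<open>A map of a finite set onto itself is injective.\<close>
  then have "bij_betw \<sigma> {1, 2, 3, 4} {1, 2, 3, 4}"
    by (metis bij_betw_def eq_card_imp_inj_on finite.emptyI finite_insert)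
  then have "\<sigma> permutes {1, 2, 3, 4}"
    by (rule bij_imp_permutes) (simp add: \<sigma>_def)
  then show "R i j k l"
    using R by (force simp: \<sigma>_def)
next
  fix \<sigma> :: "nat \<Rightarrow> nat"
  assume R: "\<forall>i j k l. {i, j, k, l} = {1, 2, 3, 4} \<longrightarrow> R i j k l" and "\<sigma> permutes {1, 2, 3, 4}"
  then show "R (\<sigma> 1) (\<sigma> 2) (\<sigma> 3) (\<sigma> 4)"
    using permutes_image[of \<sigma> "{1, 2, 3, 4}"] by simp
qed

text \<open>Each sum joins two opposite faces, orthogonal to axis 1, 2 and 3 respectively. In it the
  translation terms that mix two axes cancel. What remains are the terms t_i = d_i^2 det(b, e_i, A
  e_i), each tied to a single axis, in cyclic differences. The bracket after
  \<open>d1 * d2 * d3\<close> is the sum of the two principal 2x2 minors containing the index of the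
  axis, minus the other two diagonal entries.\<close>

lemma opposite_edges_signed_volume_sum:
  fixes A :: "real^3^3" and b :: "real^3" and d1 d2 d3 :: real
  defines "\<Phi> \<equiv> \<lambda>x. A *v x + b"
  defines "V \<equiv> \<lambda>i j k l. signed_volume (P_vertex d1 d2 d3 i) (P_vertex d1 d2 d3 j)
                 (Q_vertex d1 d2 d3 \<Phi> k) (Q_vertex d1 d2 d3 \<Phi> l)"
  defines "t1 \<equiv> d1\<^sup>2 * (b$3 * A$2$1 - b$2 * A$3$1)"
    and "t2 \<equiv> d2\<^sup>2 * (b$1 * A$3$2 - b$3 * A$1$2)"
    and "t3 \<equiv> d3\<^sup>2 * (b$2 * A$1$3 - b$1 * A$2$3)"
  shows "V 1 4 2 3 + V 2 3 1 4 = 4/3 * (t3 - t2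
      + d1 * d2 * d3 * ((A$1$1 - 1) * (A$2$2 + A$3$3) - A$1$2 * A$2$1 - A$1$3 * A$3$1))"
    and "V 2 4 3 1 + V 3 1 2 4 = 4/3 * (t1 - t3
      + d1 * d2 * d3 * ((A$2$2 - 1) * (A$3$3 + A$1$1) - A$2$3 * A$3$2 - A$2$1 * A$1$2))"
    and "V 3 4 1 2 + V 1 2 3 4 = 4/3 * (t2 - t1
      + d1 * d2 * d3 * ((A$3$3 - 1) * (A$1$1 + A$2$2) - A$3$1 * A$1$3 - A$3$2 * A$2$3))"
  unfolding V_def \<Phi>_def t1_def t2_def t3_def signed_volume_def Q_vertex_def P_vertex_def
  by (simp_all add: det_3 matrix_vector_mult_def sum_3) algebra+

lemma signed_volume_sum_eq_0:
  fixes A :: "real^3^3" and b :: "real^3" and d1 d2 d3 :: real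
  assumes "rotation_matrix A"
  defines "\<Phi> \<equiv> \<lambda>x. A *v x + b"
  defines "V \<equiv> \<lambda>i j k l. signed_volume (P_vertex d1 d2 d3 i) (P_vertex d1 d2 d3 j)
                 (Q_vertex d1 d2 d3 \<Phi> k) (Q_vertex d1 d2 d3 \<Phi> l)"
  shows "V 1 4 2 3 + V 2 3 1 4 + V 2 4 3 1 + V 3 1 2 4 + V 3 4 1 2 + V 1 2 3 4 = 0"
proof -
  \<comment> \<open>Every principal minor and every diagonal entry occurs in two of the three sums,
    which doubles the factor 4/3.\<close>
  have "(V 1 4 2 3 + V 2 3 1 4) + (V 2 4 3 1 + V 3 1 2 4) + (V 3 4 1 2 + V 1 2 3 4) =
    8/3 * (d1 * d2 * d3) *
      ((A$2$2 * A$3$3 - A$2$3 * A$3$2 - A$1$1) + (A$1$1 * A$3$3 - A$1$3 * A$3$1 - A$2$2)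
       + (A$1$1 * A$2$2 - A$1$2 * A$2$1 - A$3$3))"
    unfolding V_def \<Phi>_def opposite_edges_signed_volume_sum by algebra
  also have "\<dots> = 0"
    \<comment> \<open>Each minor equals the diagonal entry subtracted from it, so the three brackets
      vanish separately.\<close>
    by (simp flip: rotation_matrix_eq_cofactor[OF assms(1)])
  finally show ?thesis
    by simp
qed

lemma signed_volume_basic_position:
  "signed_volume (P_vertex d1 d2 d3 1) (P_vertex d1 d2 d3 4)
    (R_vertex d1 d2 d3 2 3)
    (R_vertex d1 d2 d3 3 2) = - (4/3) * (d1 * d2 * d3)"
  "signed_volume (P_vertex d1 d2 d3 2) (P_vertex d1 d2 d3 3)
    (R_vertex d1 d2 d3 1 4)
    (R_vertex d1 d2 d3 4 1) = - (4/3) * (d1 * d2 * d3)"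
  "signed_volume (P_vertex d1 d2 d3 2) (P_vertex d1 d2 d3 4)
    (R_vertex d1 d2 d3 3 1)
    (R_vertex d1 d2 d3 1 3) = - (4/3) * (d1 * d2 * d3)"
  "signed_volume (P_vertex d1 d2 d3 3) (P_vertex d1 d2 d3 1)
    (R_vertex d1 d2 d3 2 4)
    (R_vertex d1 d2 d3 4 2) = - (4/3) * (d1 * d2 * d3)"
  "signed_volume (P_vertex d1 d2 d3 3) (P_vertex d1 d2 d3 4)
    (R_vertex d1 d2 d3 1 2)
    (R_vertex d1 d2 d3 2 1) = - (4/3) * (d1 * d2 * d3)"
  "signed_volume (P_vertex d1 d2 d3 1) (P_vertex d1 d2 d3 2)
    (R_vertex d1 d2 d3 3 4)
    (R_vertex d1 d2 d3 4 3) = - (4/3) * (d1 * d2 * d3)"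
  unfolding signed_volume_def R_vertex_def P_vertex_def
  by (simp_all add: det_3)

text \<open>The six zeros cover every choice of the unordered pair {i, j}; swaps inside the two
  pairs then reach all 24 orderings.\<close>

lemma antisymmetric_eq_0:
  fixes F :: "nat \<Rightarrow> nat \<Rightarrow> nat \<Rightarrow> nat \<Rightarrow> real"
  assumes swap: "\<And>i j k l. F j i k l = - F i j k l" "\<And>i j k l. F i j l k = - F i j k l"
    and zero: "F 1 4 2 3 = 0" "F 2 3 1 4 = 0" "F 2 4 3 1 = 0"
      "F 3 1 2 4 = 0" "F 3 4 1 2 = 0" "F 1 2 3 4 = 0"
    and eq: "{i, j, k, l} = {1, 2, 3, 4}"
  shows "F i j k l = 0"
proof -
  have swap': "F j i k l = 0" "F i j l k = 0" if "F i j k l = 0" for i j k l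
    using that swap[of j i k l] swap[of i j l k] by simp_all
  note zeros = zero zero[THEN swap'(1)]
  note zeros = zeros zeros[THEN swap'(2)]
  have "card {i, j, k, l} = 4"
    unfolding eq by simp
  then have "i \<noteq> j" "i \<noteq> k" "i \<noteq> l" "j \<noteq> k" "j \<noteq> l" "k \<noteq> l"
    by (auto simp: card_insert_if split: if_splits)
  moreover have "i \<in> {1, 2, 3, 4}" "j \<in> {1, 2, 3, 4}" "k \<in> {1, 2, 3, 4}" "l \<in> {1, 2, 3, 4}"
    using eq by blast+
  ultimately show ?thesis
    \<comment> \<open>All 256 index tuples are enumerated, and those with a repetition contradict
      distinctness. Removing \<open>One_nat_def\<close> keeps the index 1 from becoming
      \<open>Suc 0\<close>.\<close>
    by (elim insertE emptyE) (simp_all add: zeros del: One_nat_def)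
qed

theorem theorem2:
  fixes d1 d2 d3 :: real and A :: "real^3^3" and b :: "real^3"
  assumes "d1 > 0" and "d2 > 0" and "d3 > 0"
    and "rotation_matrix A"
  shows "generalized_admitted_motion d1 d2 d3 (\<lambda>x. A *v x + b) \<longleftrightarrow>
         admitted_motion d1 d2 d3 (\<lambda>x. A *v x + b)"
proof -
  define \<Phi> where "\<Phi> = (\<lambda>x. A *v x + b)"
  define V where "V i j k l = signed_volume (P_vertex d1 d2 d3 i) (P_vertex d1 d2 d3 j)
    (Q_vertex d1 d2 d3 \<Phi> k) (Q_vertex d1 d2 d3 \<Phi> l)" for i j k l
  define V0 where "V0 i j k l = signed_volume (P_vertex d1 d2 d3 i) (P_vertex d1 d2 d3 j)
    (R_vertex d1 d2 d3 k l)
    (R_vertex d1 d2 d3 l k)" for i j k l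
  have gen: "generalized_admitted_motion d1 d2 d3 \<Phi> \<longleftrightarrow> is_motion \<Phi> \<and>
    (\<forall>i j k l. {i, j, k, l} = {1, 2, 3, 4} \<longrightarrow> V i j k l = 0 \<or> sgn (V i j k l) = - sgn (V0 i j k l))"
    unfolding generalized_admitted_motion_def Let_def V_def [symmetric] V0_def [symmetric]
      permutes_4_iff [of "\<lambda>i j k l. V i j k l = 0 \<or> sgn (V i j k l) = - sgn (V0 i j k l)"] ..
  have adm: "admitted_motion d1 d2 d3 \<Phi> \<longleftrightarrow> is_motion \<Phi> \<and>
    (\<forall>i j k l. {i, j, k, l} = {1, 2, 3, 4} \<longrightarrow> V i j k l = 0)"
    unfolding admitted_motion_def coplanar_iff_signed_volume_eq_0 V_def [symmetric]
      permutes_4_iff [of "\<lambda>i j k l. V i j k l = 0"] ..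
  have "V i j k l = 0"
    if sgn: "\<And>i j k l. {i, j, k, l} = {1, 2, 3, 4} \<Longrightarrow>
        V i j k l = 0 \<or> sgn (V i j k l) = - sgn (V0 i j k l)"
      and "{i, j, k, l} = {1, 2, 3, 4}" for i j k l
  proof -
    have nonneg: "V i j k l \<ge> 0"
      if "{i, j, k, l} = {1, 2, 3, 4}" "V0 i j k l = - (4/3) * (d1 * d2 * d3)"
      for i j k l
    proof -
      \<comment> \<open>Here the positivity of the d_i enters: it fixes the sign of the reference
        volume, so a nonzero \<open>V\<close> must be positive.\<close>
      have "V0 i j k l < 0"
        using that(2) assms by simp
      with sgn[OF that(1)] have "V i j k l = 0 \<or> sgn (V i j k l) = 1"
        by simp
      then show ?thesis
        by (auto simp: sgn_1_pos)
    qed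
    note V0 = signed_volume_basic_position[of d1 d2 d3, folded V0_def]
    have "V 1 4 2 3 \<ge> 0" "V 2 3 1 4 \<ge> 0" "V 2 4 3 1 \<ge> 0"
      "V 3 1 2 4 \<ge> 0" "V 3 4 1 2 \<ge> 0" "V 1 2 3 4 \<ge> 0"
      by (rule nonneg; (rule V0 | auto))+
    moreover have "V 1 4 2 3 + V 2 3 1 4 + V 2 4 3 1 + V 3 1 2 4 + V 3 4 1 2 + V 1 2 3 4 = 0"
      using signed_volume_sum_eq_0[OF assms(4), of d1 d2 d3 b]
      unfolding V_def \<Phi>_def .
    ultimately have zero: "V 1 4 2 3 = 0" "V 2 3 1 4 = 0" "V 2 4 3 1 = 0"
      "V 3 1 2 4 = 0" "V 3 4 1 2 = 0" "V 1 2 3 4 = 0"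
      by linarith+
    show ?thesis
      by (rule antisymmetric_eq_0[of V, OF _ _ zero that(2)])
        (simp_all only: V_def, (rule signed_volume_swap)+)
  qed
  \<comment> \<open>The converse is immediate, since vanishing volumes satisfy the first alternative
    of the generalized condition.\<close>
  then have "generalized_admitted_motion d1 d2 d3 \<Phi> \<longleftrightarrow> admitted_motion d1 d2 d3 \<Phi>"
    unfolding gen adm by meson
  then show ?thesis
    unfolding \<Phi>_def .
qed

end
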